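(* Assume the hypotheses on $f,g,\Lambda,G$ and on the initial data listed in the context, and let $T>0$ be fixed. Then there exists a constant $C$, independent of $\varepsilon,\delta t,\Delta t,M$ and $n$, such that for all $0<\varepsilon<1$, all $\delta t,\Delta t>0$ and integers $M\ge 1$ satisfying the conditions (A6), (A7), (A8) of the context, and every integer $n\ge 1$ with $n t_\Delta\le T$, the error $\mathcal E^n=|y_\varepsilon(t^n)-y^n|$ between the exact slow solution of the full multiscale system and the projective integration estimate satisfies $$\mathcal E^n\le\begin{cases} C\left(t_\Delta+\varepsilon+\left(\frac{\varepsilon}{t_\Delta}+\varepsilon+e^{-\frac{M\delta t}{\varepsilon}}\right)|d^n|\right) & \text{if } 0<\delta t\le\frac{2\varepsilon}{\lambda+1},\\[2mm] C\,\frac{\delta t}{\delta t^*}\left(t_\Delta+\varepsilon+\left(\frac{\varepsilon}{t_\Delta}+\varepsilon+e^{-\frac{M\delta t^*}{\varepsilon}}\right)|d^n|\right) & \text{if } \frac{2\varepsilon}{\lambda+1}<\delta t<\frac{2\varepsilon}{\lambda},\end{cases}$$ where $\delta t^*=2\varepsilon-\lambda\,\delta t$ and $|d^n|=\max_{0\le i\le n-1}|x^i-\bar f(y^i)|$ is the maximal distance of the fast variables from the approximate centre manifold $x=\bar f(y)$ over the macrosteps, which is estimated by $$|d^n|\le\begin{cases} |x^0-\bar f(y^0)|+\dfrac{\varepsilon L_fC_g(1+\lambda)\Delta t}{\varepsilon-\Delta t\,\lambda\, e^{-\frac{M\delta t}{\varepsilon}}} & \text{if } 0<\delta t\le\frac{2\varepsilon}{\lambda+1},\\[3mm]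 |x^0-\bar f(y^0)|+\dfrac{\varepsilon L_fC_g\left(1+\frac{\delta t}{\delta t^*}\lambda\right)\Delta t}{\varepsilon-\Delta t\,\lambda\, e^{-\frac{M\delta t^*}{\varepsilon}}} & \text{if } \frac{2\varepsilon}{\lambda+1}<\delta t<\frac{2\varepsilon}{\lambda}.\end{cases}$$
   Context: Throughout $|\cdot|$ is the Euclidean norm. Full system: for slow variables $y_\varepsilon(t)\in\mathbb R^n$ and fast variables $x_\varepsilon(t)\in\mathbb R^m$ (these dimensions are unrelated to the indices $n,m$ used below), $$\dot y_\varepsilon=g(x_\varepsilon,y_\varepsilon),\qquad \dot x_\varepsilon=\frac1\varepsilon\left(-\Lambda x_\varepsilon+f(y_\varepsilon)\right),$$ where $\Lambda$ is a real diagonal matrix with positive diagonal entries $\lambda_{ii}$, $\min_i\lambda_{ii}=1$ and $\max_i\lambda_{ii}=\lambda$, and $(x_\varepsilon,y_\varepsilon)=(0,0)$ is a fixed point. Put $\bar f(y)=\Lambda^{-1}f(y)$ and $G(y)=g(\bar f(y),y)$; the reduced system is $\dot Y=G(Y)$. Projective integration (PI) with microstep $\delta t$, macrostep $\Delta t$ and $M$ microsteps: given $(x^n,y^n)$ set $x^{n,0}=x^n$, $y^{n,0}=y^n$; for $m=0,\dots,M-1$, $$x^{n,m+1}=x^{n,m}-\tfrac{\delta t}{\varepsilon}\left(\Lambda x^{n,m}-f(y^{n,m})\right),\qquad y^{n,m+1}=y^{n,m}+\delta t\,g(x^{n,m},y^{n,m});$$ then $$x^{n+1}=x^{n,M}-\tfrac{\Delta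 t}{\varepsilon}\left(\Lambda x^{n,M}-f(y^{n,M})\right),\qquad y^{n+1}=y^{n,M}+\Delta t\,g(x^{n,M},y^{n,M}).$$ Put $t_\Delta=\Delta t+M\delta t$ and $t^n=n t_\Delta$. Assumptions. (A1) $|f(y_1)-f(y_2)|\le L_f|y_1-y_2|$ for all $y_1,y_2$. (A2) $|g(x_1,y_1)-g(x_2,y_2)|\le L_g(|x_1-x_2|+|y_1-y_2|)$ for all arguments. (A3) $C_f=\sup|f(y)|<\infty$. (A4) $C_g=\sup|g(x,y)|<\infty$. (A5) $G$ is of class $C^1$ and $C^*=\sup|\ddot Y(t)|<\infty$, the supremum being over solutions of $\dot Y=G(Y)$. (A6) $0<\delta t\le \frac{2\varepsilon}{\lambda}<\Delta t$. (A7) $L_G M\delta t\le L_g(1+L_f)M\delta t\le 1$, where $L_G\le L_g(1+L_f)$ is the Lipschitz constant of $G$. (A8) $\Delta t\,e^{-M\delta t/\varepsilon}<\frac{\varepsilon}{\lambda}$ if $0<\delta t\le\frac{2\varepsilon}{\lambda+1}$, or $\Delta t\,e^{-M\delta t^*/\varepsilon}<\frac{\varepsilon}{\lambda}$ if $\frac{2\varepsilon}{\lambda+1}<\delta t<\frac{2\varepsilon}{\lambda}$, with $\delta t^*=2\varepsilon-\lambda\delta t$. Initial data: the PI scheme is started at $y^0=Y(0)$, where $Y$ solves $\dot Y=G(Y)$, with $x^0$ given; the full system has $y_\varepsilon(0)=Y(0)+c_{0,y}\,\varepsilon$ and $x_\varepsilon(0)=\bar f(y_\varepsilon(0))+c_{0,x}$,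 with fixed vectors $c_{0,y},c_{0,x}$ independent of $\varepsilon$. The constant $C$ may depend on $\Lambda,f,g,T,c_{0,y},c_{0,x}$. *)

theory Defs
  imports "HOL-Analysis.Analysis"
begin

definition diagonal_matrix :: "real^'m^'m \<Rightarrow> bool" where
  "diagonal_matrix \<Lambda> \<longleftrightarrow> (\<forall>i j. i \<noteq> j \<longrightarrow> \<Lambda> $ i $ j = 0)"

definition C1_on_UNIV :: "('a::real_normed_vector \<Rightarrow> 'b::real_normed_vector) \<Rightarrow> bool" where
  "C1_on_UNIV G \<longleftrightarrow>
     (\<exists>G' :: 'a \<Rightarrow> 'a \<Rightarrow>\<^sub>L 'b.
        (\<forall>y. (G has_derivative blinfun_apply (G' y)) (at y)) \<and> continuous_on UNIV G')"

definition fbar :: "real^'m^'m \<Rightarrow> (real^'n \<Rightarrow> real^'m) \<Rightarrow> real^'n \<Rightarrow> real^'m" where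
  "fbar \<Lambda> f y = matrix_inv \<Lambda> *v f y"

definition reduced_field ::
  "real^'m^'m \<Rightarrow> (real^'n \<Rightarrow> real^'m) \<Rightarrow> (real^'m \<Rightarrow> real^'n \<Rightarrow> real^'n) \<Rightarrow> real^'n \<Rightarrow> real^'n" where
  "reduced_field \<Lambda> f g y = g (fbar \<Lambda> f y) y"

text \<open>All solutions are forward-in-time solutions on \<open>{0..}\<close>; at time 0 the derivative
  is one-sided.\<close>

definition solves_ode :: "('a::real_normed_vector \<Rightarrow> 'a) \<Rightarrow> (real \<Rightarrow> 'a) \<Rightarrow> bool" where
  "solves_ode G Y \<longleftrightarrow> (\<forall>t\<ge>0. (Y has_vector_derivative G (Y t)) (at t within {0..}))"

definition second_derivative :: "(real \<Rightarrow> 'a::real_normed_vector) \<Rightarrow> real \<Rightarrow> 'a" where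
  "second_derivative Y t =
     vector_derivative (\<lambda>s. vector_derivative Y (at s within {0..})) (at t within {0..})"

definition solves_full ::
  "real^'m^'m \<Rightarrow> (real^'n \<Rightarrow> real^'m) \<Rightarrow> (real^'m \<Rightarrow> real^'n \<Rightarrow> real^'n) \<Rightarrow> real
    \<Rightarrow> (real \<Rightarrow> real^'m) \<Rightarrow> (real \<Rightarrow> real^'n) \<Rightarrow> bool" where
  "solves_full \<Lambda> f g \<epsilon> x y \<longleftrightarrow>
     (\<forall>t\<ge>0. (y has_vector_derivative g (x t) (y t)) (at t within {0..}) \<and>
            (x has_vector_derivative (1 / \<epsilon>) *\<^sub>R (- (\<Lambda> *v x t) + f (y t))) (at t within {0..}))"

text \<open>Microsteps and macrosteps are the same forward Euler step for the full system,
  with step sizes \<open>\<delta>t\<close> and \<open>\<Delta>t\<close>.\<close>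

definition euler_step ::
  "real^'m^'m \<Rightarrow> (real^'n \<Rightarrow> real^'m) \<Rightarrow> (real^'m \<Rightarrow> real^'n \<Rightarrow> real^'n) \<Rightarrow> real \<Rightarrow> real
    \<Rightarrow> (real^'m) \<times> (real^'n) \<Rightarrow> (real^'m) \<times> (real^'n)" where
  "euler_step \<Lambda> f g \<epsilon> h = (\<lambda>(x, y). (x - (h / \<epsilon>) *\<^sub>R (\<Lambda> *v x - f y), y + h *\<^sub>R g x y))"

definition pi_step ::
  "real^'m^'m \<Rightarrow> (real^'n \<Rightarrow> real^'m) \<Rightarrow> (real^'m \<Rightarrow> real^'n \<Rightarrow> real^'n) \<Rightarrow> real \<Rightarrow> real \<Rightarrow> real \<Rightarrow> nat
    \<Rightarrow> (real^'m) \<times> (real^'n) \<Rightarrow> (real^'m) \<times> (real^'n)" where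
  "pi_step \<Lambda> f g \<epsilon> \<delta>t \<Delta>t M p =
     euler_step \<Lambda> f g \<epsilon> \<Delta>t ((euler_step \<Lambda> f g \<epsilon> \<delta>t ^^ M) p)"

definition pi_iter ::
  "real^'m^'m \<Rightarrow> (real^'n \<Rightarrow> real^'m) \<Rightarrow> (real^'m \<Rightarrow> real^'n \<Rightarrow> real^'n) \<Rightarrow> real \<Rightarrow> real \<Rightarrow> real \<Rightarrow> nat
    \<Rightarrow> real^'m \<Rightarrow> real^'n \<Rightarrow> nat \<Rightarrow> (real^'m) \<times> (real^'n)" where
  "pi_iter \<Lambda> f g \<epsilon> \<delta>t \<Delta>t M x0 y0 n = (pi_step \<Lambda> f g \<epsilon> \<delta>t \<Delta>t M ^^ n) (x0, y0)"

definition manifold_dist ::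
  "real^'m^'m \<Rightarrow> (real^'n \<Rightarrow> real^'m) \<Rightarrow> (real^'m) \<times> (real^'n) \<Rightarrow> real" where
  "manifold_dist \<Lambda> f = (\<lambda>(x, y). norm (x - fbar \<Lambda> f y))"

text \<open>Only meaningful for \<open>n \<ge> 1\<close>, since \<open>Max {}\<close> is unspecified.\<close>

definition max_manifold_dist ::
  "real^'m^'m \<Rightarrow> (real^'n \<Rightarrow> real^'m) \<Rightarrow> (nat \<Rightarrow> (real^'m) \<times> (real^'n)) \<Rightarrow> nat \<Rightarrow> real" where
  "max_manifold_dist \<Lambda> f p n = Max ((\<lambda>i. manifold_dist \<Lambda> f (p i)) ` {0..n-1})"

end

theory Submission
  imports Defs
begin

text \<open>The reduced solution \<open>Y\<close> is compared with both sides. Write \<open>L = Lg * (1 + Lf)\<close>, a Lipschitz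
  constant of the reduced field.

  The exact slow variable differs from \<open>Y\<close> by \<open>O(\<epsilon>)\<close>. Each component of the fast variable relaxes
  exponentially, at rate at least \<open>1 / \<epsilon>\<close>, to the manifold point \<open>fbar (y t)\<close>, which moves with
  speed at most \<open>Lf * Cg\<close>; hence the distance to the manifold is at most a multiple of
  \<open>exp (- t / \<epsilon>) + \<epsilon>\<close>, and its integral, which drives the difference of the slow variables through
  Gronwall's inequality, is \<open>O(\<epsilon>)\<close> (\<open>full_solution_manifold_dist\<close>, \<open>full_reduced_distance\<close>).

  On the numerical side everything rests on the contraction of a microstep towards the manifold.
  In the first regime its factor is \<open>1 - \<delta>t / \<epsilon>\<close>, in the second it is \<open>1 - \<delta>s / \<epsilon>\<close>; both have the
  form \<open>1 - \<delta>t / \<tau>\<close>, with \<open>\<tau> = \<epsilon>\<close> or \<open>\<tau> = \<epsilon> * \<delta>t / \<delta>s\<close>, so the two cases of the estimate are one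
  statement about \<open>\<tau>\<close>. Summing the geometric decay, the microsteps reduce an initial distance \<open>D\<close>
  to \<open>exp (- M * \<delta>t / \<tau>) * D\<close> plus a tracking error \<open>Lf * Cg * \<tau>\<close>, while the macrostep amplifies
  it by at most \<open>lmax * \<Delta>t / \<epsilon>\<close>. The damping hypothesis \<open>\<Delta>t * exp (- M * \<delta>t / \<tau>) < \<epsilon> / lmax\<close> makes
  the product of the two factors less than one, and the resulting affine recursion gives the bound
  on the maximal distance (\<open>manifold_dist_iterates\<close>).

  Over one step of length \<open>H\<close> the slow variable of the scheme then moves by \<open>H *\<^sub>R G\<close> with an error
  of order \<open>H\<^sup>2 + \<tau> * H + (\<tau> + \<Delta>t * exp (- M * \<delta>t / \<tau>)) * D\<close> (\<open>slow_increment_step\<close>), and the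
  reduced flow moves by \<open>H *\<^sub>R G\<close> up to \<open>L * Cg * H\<^sup>2\<close>. A discrete Gronwall inequality over the at
  most \<open>T / H\<close> steps divides these local errors by \<open>H\<close> (\<open>reduced_error\<close>). Since \<open>\<tau> \<ge> \<epsilon>\<close>, the ratio
  \<open>\<tau> / \<epsilon>\<close> factors out of the sum of both contributions.\<close>

section \<open>Differential inequalities on the half line\<close>

lemma half_line_nonincreasing:
  fixes h :: "real \<Rightarrow> real"
  assumes deriv: "\<And>s. 0 \<le> s \<Longrightarrow> (h has_real_derivative h' s) (at s within {0..})"
    and nonpos: "\<And>s. 0 \<le> s \<Longrightarrow> s \<le> t \<Longrightarrow> h' s \<le> 0"
    and t: "0 \<le> t"
  shows "h t \<le> h 0"
proof (rule DERIV_nonpos_imp_decreasing_open [OF t])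
  fix s assume s: "0 < s" "s < t"
  have "at s within {0..} = at s"
    using s by (intro at_within_interior) auto
  then show "\<exists>d. (h has_real_derivative d) (at s) \<and> d \<le> 0"
    using deriv [of s] nonpos [of s] s by (intro exI [of _ "h' s"]) auto
next
  have "continuous_on {0..} h"
    by (rule DERIV_continuous_on) (use deriv in auto)
  then show "continuous_on {0..t} h"
    by (rule continuous_on_subset) auto
qed

text \<open>The target is frozen at its final value \<open>w t\<close>; then the integrating factor \<open>exp (a * s)\<close>
  leaves a right hand side whose primitive \<open>K * exp (a * s) * (t - s + 1 / a)\<close> is explicit. A
  Lipschitz target is the right generality, since the centre manifold below is merely Lipschitz.\<close>

lemma relaxation_to_moving_target:
  fixes u w :: "real \<Rightarrow> real"
  assumes a: "0 < a" and t: "0 \<le> t"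
    and deriv: "\<And>s. 0 \<le> s \<Longrightarrow> (u has_real_derivative - (a * (u s - w s))) (at s within {0..})"
    and target: "\<And>s s'. 0 \<le> s \<Longrightarrow> 0 \<le> s' \<Longrightarrow> \<bar>w s - w s'\<bar> \<le> K * \<bar>s - s'\<bar>"
  shows "\<bar>u t - w t\<bar> \<le> exp (- (a * t)) * \<bar>u 0 - w 0\<bar> + K / a"
proof -
  have bound: "\<sigma> * (u t - w t) \<le> exp (- (a * t)) * \<bar>u 0 - w 0\<bar> + K / a"
    if \<sigma>: "\<sigma> = 1 \<or> \<sigma> = -1" for \<sigma> :: real
  proof -
    define h where "h s = exp (a * s) * (\<sigma> * (u s - w t) - K * (t - s + 1 / a))" for s
    have "h t \<le> h 0"
    proof (rule half_line_nonincreasing [OF _ _ t])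
      fix s :: real assume s: "0 \<le> s"
      show "(h has_real_derivative a * exp (a * s) * (\<sigma> * (w s - w t) - K * (t - s)))
              (at s within {0..})"
        unfolding h_def
        by (rule derivative_eq_intros deriv s refl)+
          (use a in \<open>simp add: field_simps\<close>)
    next
      fix s :: real assume s: "0 \<le> s" "s \<le> t"
      have "\<sigma> * (w s - w t) \<le> \<bar>w s - w t\<bar>" using \<sigma> by auto
      also have "\<dots> \<le> K * (t - s)" using target [of s t] s t by simp
      finally show "a * exp (a * s) * (\<sigma> * (w s - w t) - K * (t - s)) \<le> 0"
        using a by (simp add: mult_nonneg_nonpos)
    qed
    moreover have "h 0 \<le> \<bar>u 0 - w 0\<bar> - K / a"
    proof -
      have "\<sigma> * (u 0 - w t) \<le> \<bar>u 0 - w 0\<bar> + \<bar>w 0 - w t\<bar>" using \<sigma> by auto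
      also have "\<bar>w 0 - w t\<bar> \<le> K * t" using target [of 0 t] t by simp
      finally show ?thesis by (simp add: h_def algebra_simps)
    qed
    moreover have "0 \<le> K / a"
      using target [of 0 1] a by simp
    ultimately have "exp (a * t) * (\<sigma> * (u t - w t) - K / a) \<le> \<bar>u 0 - w 0\<bar>"
      by (simp add: h_def)
    then have "exp (- (a * t)) * (exp (a * t) * (\<sigma> * (u t - w t) - K / a))
        \<le> exp (- (a * t)) * \<bar>u 0 - w 0\<bar>"
      by (rule mult_left_mono) simp
    then show ?thesis
      by (simp add: mult.assoc [symmetric] exp_add [symmetric])
  qed
  from bound [of 1] bound [of "-1"] show ?thesis by (simp add: abs_le_iff)
qed

text \<open>A Gronwall inequality. The norm need not be differentiable at a zero of \<open>z\<close>, so the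
  regularised norm \<open>sqrt (z \<bullet> z + \<eta>\<^sup>2)\<close> takes its place; it satisfies the same differential
  inequality, and \<open>\<eta>\<close> tends to zero at the end.\<close>

lemma gronwall_norm:
  fixes z :: "real \<Rightarrow> 'a::real_inner"
  assumes deriv: "\<And>s. 0 \<le> s \<Longrightarrow> (z has_vector_derivative z' s) (at s within {0..})"
    and growth: "\<And>s. 0 \<le> s \<Longrightarrow> norm (z' s) \<le> L * norm (z s) + b s"
    and primitive: "\<And>s. 0 \<le> s \<Longrightarrow> (B has_real_derivative b s) (at s within {0..})"
    and b_nonneg: "\<And>s. 0 \<le> s \<Longrightarrow> 0 \<le> b s"
    and L: "0 \<le> L" and t: "0 \<le> t"
  shows "norm (z t) \<le> exp (L * t) * (norm (z 0) + (B t - B 0))"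
proof (rule field_le_epsilon)
  fix e :: real assume e: "0 < e"
  define \<eta> where "\<eta> = exp (- (L * t)) * e"
  have \<eta>: "0 < \<eta>" using e by (simp add: \<eta>_def)
  define v where "v s = sqrt (z s \<bullet> z s + \<eta>\<^sup>2)" for s
  have inside: "0 < z s \<bullet> z s + \<eta>\<^sup>2" for s
    using \<eta> by (simp add: add_nonneg_pos)
  have v_pos: "0 < v s" for s by (simp add: v_def inside)
  have norm_le_v: "norm (z s) \<le> v s" for s
    unfolding v_def norm_eq_sqrt_inner by (rule real_sqrt_le_mono) simp
  have v0: "v 0 \<le> norm (z 0) + \<eta>"
    unfolding v_def using \<eta>
    by (intro real_le_lsqrt) (auto simp: power2_eq_square algebra_simps dot_square_norm)
  have inner_deriv: "((\<lambda>s. z s \<bullet> z s) has_real_derivative 2 * (z s \<bullet> z' s)) (at s within {0..})"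
    if "0 \<le> s" for s
  proof -
    have d: "(z has_derivative (\<lambda>h. h *\<^sub>R z' s)) (at s within {0..})"
      using deriv [OF that] by (simp add: has_vector_derivative_def)
    show ?thesis
      unfolding has_field_derivative_def
      by (rule has_derivative_eq_rhs [OF has_derivative_inner [OF d d]])
        (simp add: fun_eq_iff inner_commute [of "z' s"])
  qed
  have v_deriv: "(v has_real_derivative (z s \<bullet> z' s) / v s) (at s within {0..})"
    if s: "0 \<le> s" for s
  proof -
    have "((\<lambda>s. z s \<bullet> z s + \<eta>\<^sup>2) has_real_derivative 2 * (z s \<bullet> z' s)) (at s within {0..})"
      using DERIV_add [OF inner_deriv [OF s] DERIV_const] by simp
    from DERIV_chain2 [OF DERIV_real_sqrt [OF inside] this]
    have "(v has_real_derivative inverse (v s) / 2 * (2 * (z s \<bullet> z' s))) (at s within {0..})"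
      by (simp only: v_def [abs_def])
    moreover have "inverse (v s) / 2 * (2 * (z s \<bullet> z' s)) = (z s \<bullet> z' s) / v s"
      by (simp add: inverse_eq_divide)
    ultimately show ?thesis by simp
  qed
  have v_growth: "(z s \<bullet> z' s) / v s \<le> L * v s + b s" if s: "0 \<le> s" for s
  proof -
    have "z s \<bullet> z' s \<le> norm (z s) * norm (z' s)" by (rule norm_cauchy_schwarz)
    also have "\<dots> \<le> v s * (L * v s + b s)"
    proof (rule mult_mono)
      have "L * norm (z s) \<le> L * v s" by (rule mult_left_mono [OF norm_le_v L])
      then show "norm (z' s) \<le> L * v s + b s" using growth [OF s] by simp
    qed (use norm_le_v v_pos [of s] in auto)
    finally show ?thesis using v_pos [of s] by (simp add: pos_divide_le_eq mult.commute)
  qed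
  define h where "h s = exp (- (L * s)) * v s - B s" for s
  have "h t \<le> h 0"
  proof (rule half_line_nonincreasing [OF _ _ t])
    fix s :: real assume s: "0 \<le> s"
    show "(h has_real_derivative exp (- (L * s)) * ((z s \<bullet> z' s) / v s - L * v s) - b s)
            (at s within {0..})"
      unfolding h_def
      by (rule derivative_eq_intros v_deriv primitive s refl)+ (simp add: algebra_simps)
  next
    fix s :: real assume s: "0 \<le> s"
    have "exp (- (L * s)) * ((z s \<bullet> z' s) / v s - L * v s) \<le> exp (- (L * s)) * b s"
      using v_growth [OF s] by (intro mult_left_mono) auto
    also have "\<dots> \<le> 1 * b s"
      using b_nonneg [OF s] L s by (intro mult_right_mono) auto
    finally show "exp (- (L * s)) * ((z s \<bullet> z' s) / v s - L * v s) - b s \<le> 0" by simp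
  qed
  then have "exp (- (L * t)) * v t \<le> norm (z 0) + \<eta> + (B t - B 0)"
    using v0 by (simp add: h_def)
  then have "exp (L * t) * (exp (- (L * t)) * v t)
      \<le> exp (L * t) * (norm (z 0) + \<eta> + (B t - B 0))"
    by (rule mult_left_mono) simp
  then have "v t \<le> exp (L * t) * (norm (z 0) + (B t - B 0)) + exp (L * t) * \<eta>"
    by (simp add: mult.assoc [symmetric] exp_add [symmetric] distrib_left)
  moreover have "exp (L * t) * \<eta> = e"
    by (simp add: \<eta>_def mult.assoc [symmetric] exp_add [symmetric])
  ultimately show "norm (z t) \<le> exp (L * t) * (norm (z 0) + (B t - B 0)) + e"
    using norm_le_v [of t] by simp
qed

lemma lipschitz_of_bounded_derivative:
  fixes y :: "real \<Rightarrow> 'a::real_normed_vector"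
  assumes deriv: "\<And>s. 0 \<le> s \<Longrightarrow> (y has_vector_derivative y' s) (at s within {0..})"
    and bound: "\<And>s. 0 \<le> s \<Longrightarrow> norm (y' s) \<le> K"
    and s: "0 \<le> s" and s': "0 \<le> s'"
  shows "norm (y s - y s') \<le> K * \<bar>s - s'\<bar>"
proof -
  have "norm (y s - y s') \<le> K * norm (s - s')"
  proof (rule differentiable_bound)
    show "(y has_derivative (\<lambda>h. h *\<^sub>R y' r)) (at r within {0..})" if "r \<in> {0..}" for r
      using deriv [of r] that by (simp add: has_vector_derivative_def)
    show "onorm (\<lambda>h. h *\<^sub>R y' r) \<le> K" if "r \<in> {0..}" for r
      using bound [of r] that by (intro onorm_le) (auto simp: mult.commute [of K] intro: mult_left_mono)
  qed (use s s' in auto)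
  then show ?thesis by simp
qed

section \<open>Linear recursions\<close>

lemma affine_recursion_bound:
  fixes a :: "nat \<Rightarrow> real"
  assumes step: "\<And>k. a (Suc k) \<le> q * a k + c"
    and q: "0 \<le> q" "q < 1"
  shows "a k \<le> q ^ k * a 0 + c * (1 - q ^ k) / (1 - q)"
proof (induction k)
  case (Suc k)
  have "a (Suc k) \<le> q * (q ^ k * a 0 + c * (1 - q ^ k) / (1 - q)) + c"
    using step [of k] mult_left_mono [OF Suc q(1)] by linarith
  also have "\<dots> = q ^ Suc k * a 0 + c * (1 - q ^ Suc k) / (1 - q)"
    using q by (simp add: field_simps)
  finally show ?case .
qed simp

corollary affine_recursion_uniform_bound:
  fixes a :: "nat \<Rightarrow> real"
  assumes step: "\<And>k. a (Suc k) \<le> q * a k + c"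
    and q: "0 \<le> q" "q < 1" and c: "0 \<le> c" and a0: "0 \<le> a 0"
  shows "a k \<le> a 0 + c / (1 - q)"
proof -
  have "q ^ k * a 0 \<le> 1 * a 0"
    by (rule mult_right_mono) (use q a0 in \<open>auto intro: power_le_one\<close>)
  moreover have "c * (1 - q ^ k) / (1 - q) \<le> c / (1 - q)"
    using q c by (intro divide_right_mono mult_left_le) auto
  ultimately show ?thesis
    using affine_recursion_bound [of a q c k] step q by simp
qed

lemma discrete_gronwall:
  fixes e :: "nat \<Rightarrow> real"
  assumes step: "\<And>i. i < k \<Longrightarrow> e (Suc i) \<le> (1 + c) * e i + b"
    and e0: "e 0 \<le> 0" and c: "0 \<le> c" and b: "0 \<le> b"
  shows "e k \<le> exp (c * real k) * (real k * b)"
  using step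
proof (induction k)
  case (Suc k)
  let ?E = "exp (c * real (Suc k))"
  have IH: "e k \<le> exp (c * real k) * (real k * b)"
    using Suc.prems by (intro Suc.IH) simp
  have "e (Suc k) \<le> (1 + c) * e k + b" using Suc.prems by simp
  also have "(1 + c) * e k \<le> (1 + c) * (exp (c * real k) * (real k * b))"
    using IH c by (intro mult_left_mono) auto
  also have "\<dots> \<le> exp c * (exp (c * real k) * (real k * b))"
    using b c by (intro mult_right_mono exp_ge_add_one_self) auto
  also have "\<dots> = ?E * (real k * b)"
    by (simp add: exp_add [symmetric] algebra_simps)
  finally have "e (Suc k) \<le> ?E * (real k * b) + b" by simp
  moreover have "b \<le> ?E * b"
    using b c mult_right_mono [of 1 ?E b] by simp
  ultimately have "e (Suc k) \<le> ?E * (real k * b) + ?E * b" by linarith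
  then show ?case by (simp add: distrib_left distrib_right add.commute)
qed (use e0 in simp)

section \<open>Relaxation with a diagonal matrix\<close>

lemma diagonal_matrix_vector_mult_nth:
  assumes "diagonal_matrix A"
  shows "(A *v x) $ i = A $ i $ i * x $ i"
proof -
  have "(A *v x) $ i = (\<Sum>j\<in>UNIV. A $ i $ j * x $ j)"
    by (simp add: matrix_vector_mult_def)
  also have "\<dots> = (\<Sum>j\<in>UNIV. if j = i then A $ i $ i * x $ i else 0)"
    using assms by (intro sum.cong) (auto simp: diagonal_matrix_def)
  finally show ?thesis by simp
qed

lemma diagonal_matrix_mult_inv:
  assumes "diagonal_matrix A" and "\<And>i. A $ i $ i \<noteq> 0"
  shows "A *v (matrix_inv A *v w) = w"
proof -
  have "det A = (\<Prod>i\<in>UNIV. A $ i $ i)"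
    using assms(1) unfolding diagonal_matrix_def by (intro det_diagonal) blast
  then have "invertible A"
    using assms(2) by (simp add: invertible_det_nz)
  then have "A ** matrix_inv A = mat 1"
    unfolding invertible_def matrix_inv_def by (rule someI2_ex) auto
  then show ?thesis by (simp add: matrix_vector_mul_assoc)
qed

lemma norm_diagonal_relaxation_step:
  assumes diag: "diagonal_matrix A"
    and factor: "\<And>i. \<bar>1 - c * A $ i $ i\<bar> \<le> \<rho>"
  shows "norm (v - c *\<^sub>R (A *v v)) \<le> \<rho> * norm v"
proof -
  have \<rho>: "0 \<le> \<rho>" using factor [of undefined] by linarith
  have "norm (v - c *\<^sub>R (A *v v)) \<le> norm (\<rho> *\<^sub>R v)"
  proof (rule norm_le_componentwise_cart)
    fix i
    have "(v - c *\<^sub>R (A *v v)) $ i = (1 - c * A $ i $ i) * v $ i"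
      by (simp add: diagonal_matrix_vector_mult_nth [OF diag] algebra_simps)
    then have "norm ((v - c *\<^sub>R (A *v v)) $ i) = \<bar>1 - c * A $ i $ i\<bar> * \<bar>v $ i\<bar>"
      by (simp add: abs_mult)
    also have "\<dots> \<le> \<rho> * \<bar>v $ i\<bar>" by (rule mult_right_mono [OF factor]) simp
    finally show "norm ((v - c *\<^sub>R (A *v v)) $ i) \<le> norm ((\<rho> *\<^sub>R v) $ i)"
      using \<rho> by (simp add: abs_mult)
  qed
  then show ?thesis using \<rho> by simp
qed

section \<open>The slow-fast system and its Euler steps\<close>

locale slow_fast_system =
  fixes \<Lambda> :: "real^'m^'m"
    and f :: "real^'n \<Rightarrow> real^'m"
    and g :: "real^'m \<Rightarrow> real^'n \<Rightarrow> real^'n"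
    and lmax Lf Lg Cg \<epsilon> :: real
  assumes diagonal: "diagonal_matrix \<Lambda>"
    and rate_ge: "\<And>i. 1 \<le> \<Lambda> $ i $ i"
    and rate_le: "\<And>i. \<Lambda> $ i $ i \<le> lmax"
    and f_lipschitz: "\<And>y1 y2. norm (f y1 - f y2) \<le> Lf * norm (y1 - y2)"
    and g_lipschitz:
      "\<And>x1 x2 y1 y2. norm (g x1 y1 - g x2 y2) \<le> Lg * (norm (x1 - x2) + norm (y1 - y2))"
    and g_bounded: "\<And>x y. norm (g x y) \<le> Cg"
    and Lf_nonneg: "0 \<le> Lf" and Lg_nonneg: "0 \<le> Lg"
    and eps_pos: "0 < \<epsilon>"
begin

abbreviation G :: "real^'n \<Rightarrow> real^'n" where "G \<equiv> reduced_field \<Lambda> f g"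
abbreviation D :: "(real^'m) \<times> (real^'n) \<Rightarrow> real" where "D \<equiv> manifold_dist \<Lambda> f"
abbreviation L :: real where "L \<equiv> Lg * (1 + Lf)"

lemma lmax_ge_1: "1 \<le> lmax"
  using rate_ge [of undefined] rate_le [of undefined] by linarith

lemma Cg_nonneg: "0 \<le> Cg"
  by (rule order_trans [OF norm_ge_zero g_bounded])

lemma L_nonneg: "0 \<le> L"
  using Lf_nonneg Lg_nonneg by simp

lemma D_nonneg: "0 \<le> D p"
  by (simp add: manifold_dist_def split: prod.split)

lemma rate_mult_fbar: "\<Lambda> *v fbar \<Lambda> f y = f y"
  unfolding fbar_def
proof (rule diagonal_matrix_mult_inv [OF diagonal])
  show "\<Lambda> $ i $ i \<noteq> 0" for i using rate_ge [of i] by simp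
qed

lemma rate_mult_fbar_nth: "\<Lambda> $ i $ i * fbar \<Lambda> f y $ i = f y $ i"
  using diagonal_matrix_vector_mult_nth [OF diagonal, of "fbar \<Lambda> f y" i]
  by (simp add: rate_mult_fbar)

lemma fbar_lipschitz: "norm (fbar \<Lambda> f y1 - fbar \<Lambda> f y2) \<le> Lf * norm (y1 - y2)"
proof -
  have "norm (fbar \<Lambda> f y1 - fbar \<Lambda> f y2) \<le> norm (f y1 - f y2)"
  proof (rule norm_le_componentwise_cart)
    fix i
    have "(f y1 - f y2) $ i = \<Lambda> $ i $ i * (fbar \<Lambda> f y1 - fbar \<Lambda> f y2) $ i"
      by (simp add: right_diff_distrib rate_mult_fbar_nth)
    then have "norm ((f y1 - f y2) $ i) = \<Lambda> $ i $ i * \<bar>(fbar \<Lambda> f y1 - fbar \<Lambda> f y2) $ i\<bar>"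
      using rate_ge [of i] by (simp add: abs_mult del: vector_minus_component)
    moreover have "1 * \<bar>(fbar \<Lambda> f y1 - fbar \<Lambda> f y2) $ i\<bar>
        \<le> \<Lambda> $ i $ i * \<bar>(fbar \<Lambda> f y1 - fbar \<Lambda> f y2) $ i\<bar>"
      by (rule mult_right_mono [OF rate_ge]) simp
    ultimately show "norm ((fbar \<Lambda> f y1 - fbar \<Lambda> f y2) $ i) \<le> norm ((f y1 - f y2) $ i)"
      by simp
  qed
  then show ?thesis using f_lipschitz [of y1 y2] by linarith
qed

lemma reduced_field_lipschitz: "norm (G y1 - G y2) \<le> L * norm (y1 - y2)"
proof -
  have "norm (G y1 - G y2)
      \<le> Lg * (norm (fbar \<Lambda> f y1 - fbar \<Lambda> f y2) + norm (y1 - y2))"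
    unfolding reduced_field_def by (rule g_lipschitz)
  also have "\<dots> \<le> Lg * (Lf * norm (y1 - y2) + norm (y1 - y2))"
    by (intro mult_left_mono add_right_mono fbar_lipschitz Lg_nonneg)
  finally show ?thesis by (simp add: algebra_simps)
qed

lemma reduced_field_bounded: "norm (G y) \<le> Cg"
  by (simp add: reduced_field_def g_bounded)

lemma slow_velocity_near_manifold: "norm (g x y - G y) \<le> Lg * D (x, y)"
  using g_lipschitz [of x y "fbar \<Lambda> f y" y] by (simp add: reduced_field_def manifold_dist_def)

text \<open>The fast Euler step acts on the offset \<open>x - fbar y\<close> as \<open>1 - (h / \<epsilon>) \<Lambda>\<close>, because
  \<open>\<Lambda> fbar y = f y\<close>; moving the foot point from \<open>y\<close> to its successor costs at most
  \<open>Lf * Cg * h\<close>.\<close>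

lemma manifold_dist_euler_step:
  assumes h: "0 \<le> h"
    and factor: "\<And>i. \<bar>1 - h / \<epsilon> * \<Lambda> $ i $ i\<bar> \<le> \<rho>"
  shows "D (euler_step \<Lambda> f g \<epsilon> h q) \<le> \<rho> * D q + Lf * Cg * h"
proof (cases q)
  case (Pair x y)
  define v where "v = x - fbar \<Lambda> f y"
  define y' where "y' = y + h *\<^sub>R g x y"
  have "D (euler_step \<Lambda> f g \<epsilon> h q)
      = norm ((v - (h / \<epsilon>) *\<^sub>R (\<Lambda> *v v)) + (fbar \<Lambda> f y - fbar \<Lambda> f y'))"
    by (simp add: Pair euler_step_def manifold_dist_def v_def y'_def rate_mult_fbar
        matrix_vector_mult_diff_distrib algebra_simps)
  also have "\<dots> \<le> \<rho> * norm v + Lf * norm (y - y')"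
    by (intro norm_triangle_mono norm_diagonal_relaxation_step diagonal factor fbar_lipschitz)
  also have "\<dots> \<le> \<rho> * norm v + Lf * (h * Cg)"
  proof -
    have "norm (y - y') \<le> h * Cg"
      using h g_bounded by (simp add: y'_def mult_left_mono)
    then show ?thesis using Lf_nonneg by (simp add: mult_left_mono)
  qed
  finally show ?thesis
    by (simp only: Pair manifold_dist_def v_def prod.case mult_ac)
qed

lemma norm_slow_euler_step:
  assumes "0 \<le> h"
  shows "norm (snd (euler_step \<Lambda> f g \<epsilon> h q) - snd q) \<le> h * Cg"
  using assms g_bounded
  by (simp add: euler_step_def mult_left_mono split: prod.split)

lemma slow_increment_euler_step:
  assumes h: "0 \<le> h" and near: "norm (snd q - y) \<le> \<delta>"
  shows "norm (snd (euler_step \<Lambda> f g \<epsilon> h q) - snd q - h *\<^sub>R G y) \<le> h * (Lg * D q + L * \<delta>)"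
proof (cases q)
  case (Pair x y')
  have "norm (g x y' - G y) \<le> norm (g x y' - G y') + norm (G y' - G y)"
    using norm_triangle_ineq [of "g x y' - G y'" "G y' - G y"] by simp
  also have "\<dots> \<le> Lg * D q + L * \<delta>"
  proof (rule add_mono)
    show "norm (g x y' - G y') \<le> Lg * D q"
      using slow_velocity_near_manifold by (simp add: Pair)
    have "norm (G y' - G y) \<le> L * norm (y' - y)" by (rule reduced_field_lipschitz)
    also have "\<dots> \<le> L * \<delta>" using near L_nonneg by (intro mult_left_mono) (auto simp: Pair)
    finally show "norm (G y' - G y) \<le> L * \<delta>" .
  qed
  finally have "h * norm (g x y' - G y) \<le> h * (Lg * D q + L * \<delta>)"
    using h by (rule mult_left_mono)
  moreover have "snd (euler_step \<Lambda> f g \<epsilon> h q) - snd q - h *\<^sub>R G y = h *\<^sub>R (g x y' - G y)"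
    by (simp add: Pair euler_step_def scaleR_diff_right)
  ultimately show ?thesis using h by simp
qed

lemma reduced_solution_taylor:
  assumes Y: "solves_ode G Y" and t: "0 \<le> t" and h: "0 \<le> h"
  shows "norm (Y (t + h) - Y t - h *\<^sub>R G (Y t)) \<le> L * Cg * h\<^sup>2"
proof -
  have deriv: "(Y has_vector_derivative G (Y s)) (at s within {0..})" if "0 \<le> s" for s
    using Y that by (simp add: solves_ode_def)
  have "norm (Y (t + h) - Y t - ((t + h) - t) *\<^sub>R G (Y t)) \<le> norm ((t + h) - t) * (L * (Cg * h))"
  proof (rule vector_differentiable_bound_linearization 
      [where S = "{t..t + h}" and f' = "\<lambda>s. G (Y s)" and ?x0.0 = t])
    fix s assume s: "s \<in> {t..t + h}"
    show "(Y has_vector_derivative G (Y s)) (at s within {t..t + h})"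
      using s t by (intro has_vector_derivative_within_subset [OF deriv]) auto
    have "norm (G (Y s) - G (Y t)) \<le> L * norm (Y s - Y t)" by (rule reduced_field_lipschitz)
    also have "norm (Y s - Y t) \<le> Cg * \<bar>s - t\<bar>"
      by (rule lipschitz_of_bounded_derivative [OF deriv])
        (use s t in \<open>simp_all add: reduced_field_bounded\<close>)
    also have "\<dots> \<le> Cg * h" using s Cg_nonneg by (intro mult_left_mono) auto
    finally show "norm (G (Y s) - G (Y t)) \<le> L * (Cg * h)"
      using L_nonneg by (simp add: mult_left_mono)
  qed (use h in \<open>auto simp: closed_segment_eq_real_ivl\<close>)
  then show ?thesis using h by (simp add: power2_eq_square mult_ac)
qed

text \<open>Along the exact flow every component of the fast variable relaxes to the corresponding
  component of the moving manifold point \<open>fbar (y t)\<close>, which travels with speed at most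
  \<open>Lf * Cg\<close>.\<close>

lemma full_solution_manifold_dist:
  assumes sol: "solves_full \<Lambda> f g \<epsilon> x y" and t: "0 \<le> t"
  shows "D (x t, y t) \<le> CARD('m) * (exp (- (t / \<epsilon>)) * D (x 0, y 0) + Lf * Cg * \<epsilon>)"
proof -
  define u where "u = (\<lambda>i s. x s $ i)"
  define w where "w = (\<lambda>i s. fbar \<Lambda> f (y s) $ i)"
  have y_lip: "norm (y s - y s') \<le> Cg * \<bar>s - s'\<bar>" if "0 \<le> s" "0 \<le> s'" for s s'
    by (rule lipschitz_of_bounded_derivative [where y' = "\<lambda>s. g (x s) (y s)"])
      (use sol that g_bounded in \<open>auto simp: solves_full_def\<close>)
  have component: "\<bar>u i t - w i t\<bar> \<le> exp (- (t / \<epsilon>)) * D (x 0, y 0) + Lf * Cg * \<epsilon>" for i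
  proof -
    define a where "a = \<Lambda> $ i $ i / \<epsilon>"
    have a: "1 / \<epsilon> \<le> a" unfolding a_def using rate_ge eps_pos by (intro divide_right_mono) auto
    have a_pos: "0 < a" using a eps_pos less_le_trans [of 0 "1 / \<epsilon>" a] by simp
    have "\<bar>u i t - w i t\<bar> \<le> exp (- (a * t)) * \<bar>u i 0 - w i 0\<bar> + (Lf * Cg) / a"
    proof (rule relaxation_to_moving_target [OF a_pos t])
      fix s :: real assume s: "0 \<le> s"
      have "(x has_vector_derivative (1 / \<epsilon>) *\<^sub>R (- (\<Lambda> *v x s) + f (y s))) (at s within {0..})"
        using sol s by (simp add: solves_full_def)
      from bounded_linear.has_vector_derivative [OF bounded_linear_vec_nth this, of i]
      have "(u i has_vector_derivative ((1 / \<epsilon>) *\<^sub>R (- (\<Lambda> *v x s) + f (y s))) $ i)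
          (at s within {0..})"
        by (simp only: u_def)
      moreover have "((1 / \<epsilon>) *\<^sub>R (- (\<Lambda> *v x s) + f (y s))) $ i = - (a * (u i s - w i s))"
      proof -
        have "(- (\<Lambda> *v x s) + f (y s)) $ i = - (\<Lambda> $ i $ i * u i s) + \<Lambda> $ i $ i * w i s"
          unfolding u_def w_def
          by (simp add: rate_mult_fbar_nth diagonal_matrix_vector_mult_nth [OF diagonal])
        then show ?thesis
          by (simp only: vector_scaleR_component a_def) (simp add: diff_divide_distrib right_diff_distrib)
      qed
      ultimately show "(u i has_real_derivative - (a * (u i s - w i s))) (at s within {0..})"
        by (simp add: has_real_derivative_iff_has_vector_derivative)
    next
      fix s s' :: real assume s: "0 \<le> s" "0 \<le> s'"
      have "\<bar>w i s - w i s'\<bar> \<le> norm (fbar \<Lambda> f (y s) - fbar \<Lambda> f (y s'))"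
        using component_le_norm_cart [of "fbar \<Lambda> f (y s) - fbar \<Lambda> f (y s')" i] by (simp add: w_def)
      also have "\<dots> \<le> Lf * norm (y s - y s')" by (rule fbar_lipschitz)
      also have "\<dots> \<le> Lf * (Cg * \<bar>s - s'\<bar>)"
        by (rule mult_left_mono [OF y_lip [OF s] Lf_nonneg])
      finally show "\<bar>w i s - w i s'\<bar> \<le> Lf * Cg * \<bar>s - s'\<bar>" by (simp add: mult.assoc)
    qed
    also have "\<dots> \<le> exp (- (t / \<epsilon>)) * D (x 0, y 0) + Lf * Cg * \<epsilon>"
    proof (intro add_mono mult_mono)
      show "exp (- (a * t)) \<le> exp (- (t / \<epsilon>))"
        using mult_right_mono [OF a t] by simp
      show "\<bar>u i 0 - w i 0\<bar> \<le> D (x 0, y 0)"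
        using component_le_norm_cart [of "x 0 - fbar \<Lambda> f (y 0)" i]
        by (simp add: manifold_dist_def u_def w_def)
      have "1 / a \<le> \<epsilon>" using a a_pos eps_pos by (simp add: field_simps)
      from mult_left_mono [OF this, of "Lf * Cg"]
      show "Lf * Cg / a \<le> Lf * Cg * \<epsilon>" using Lf_nonneg Cg_nonneg by simp
    qed auto
    finally show ?thesis .
  qed
  have "D (x t, y t) \<le> (\<Sum>i\<in>UNIV. \<bar>u i t - w i t\<bar>)"
    using norm_le_l1_cart [of "x t - fbar \<Lambda> f (y t)"] by (simp add: manifold_dist_def u_def w_def)
  also have "\<dots> \<le> (\<Sum>i\<in>(UNIV :: 'm set). exp (- (t / \<epsilon>)) * D (x 0, y 0) + Lf * Cg * \<epsilon>)"
    by (rule sum_mono) (rule component)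
  finally show ?thesis by simp
qed

text \<open>The initial layer of the fast variable has height \<open>O(1)\<close> but width \<open>\<epsilon>\<close>, so after
  integration it moves the slow variable by \<open>O(\<epsilon>)\<close> only.\<close>

proposition full_reduced_distance:
  assumes sol: "solves_full \<Lambda> f g \<epsilon> x y" and Y: "solves_ode G Y"
    and t: "0 \<le> t" "t \<le> T"
  shows "norm (y t - Y t) \<le> exp (L * T)
    * (norm (y 0 - Y 0) + Lg * CARD('m) * (D (x 0, y 0) + Lf * Cg * T) * \<epsilon>)"
proof -
  define A where "A = D (x 0, y 0)"
  define N where "N = Lg * CARD('m)"
  have A: "0 \<le> A" and N: "0 \<le> N" and K: "0 \<le> Lf * Cg"
    using D_nonneg Lg_nonneg Lf_nonneg Cg_nonneg by (simp_all add: A_def N_def)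
  define b where "b s = N * (exp (- (s / \<epsilon>)) * A + Lf * Cg * \<epsilon>)" for s
  define B where "B s = N * (- \<epsilon> * exp (- (s / \<epsilon>)) * A + Lf * Cg * \<epsilon> * s)" for s
  have "norm (y t - Y t) \<le> exp (L * t) * (norm (y 0 - Y 0) + (B t - B 0))"
  proof (rule gronwall_norm [OF _ _ _ _ L_nonneg t(1)])
    fix s :: real assume s: "0 \<le> s"
    show "((\<lambda>s. y s - Y s) has_vector_derivative g (x s) (y s) - G (Y s)) (at s within {0..})"
      using sol Y s by (intro has_vector_derivative_diff) (auto simp: solves_full_def solves_ode_def)
    have "norm (g (x s) (y s) - G (Y s)) \<le> norm (g (x s) (y s) - G (y s)) + norm (G (y s) - G (Y s))"
      using norm_triangle_ineq [of "g (x s) (y s) - G (y s)" "G (y s) - G (Y s)"] by simp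
    also have "\<dots> \<le> Lg * D (x s, y s) + L * norm (y s - Y s)"
      by (intro add_mono slow_velocity_near_manifold reduced_field_lipschitz)
    also have "Lg * D (x s, y s) \<le> Lg * (CARD('m) * (exp (- (s / \<epsilon>)) * A + Lf * Cg * \<epsilon>))"
      unfolding A_def by (intro mult_left_mono full_solution_manifold_dist [OF sol s] Lg_nonneg)
    finally show "norm (g (x s) (y s) - G (Y s)) \<le> L * norm (y s - Y s) + b s"
      by (simp add: b_def N_def mult.assoc)
    show "(B has_real_derivative b s) (at s within {0..})"
      unfolding B_def b_def
      using eps_pos by (auto intro!: derivative_eq_intros simp: mult_ac)
    show "0 \<le> b s" using A N K eps_pos by (simp add: b_def)
  qed
  also have "\<dots> \<le> exp (L * T) * (norm (y 0 - Y 0) + N * (A + Lf * Cg * T) * \<epsilon>)"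
  proof (intro mult_mono add_mono order_refl)
    show "exp (L * t) \<le> exp (L * T)" using mult_left_mono [OF t(2) L_nonneg] by simp
    have "B t - B 0 = N * ((1 - exp (- (t / \<epsilon>))) * (\<epsilon> * A) + Lf * Cg * \<epsilon> * t)"
      by (simp add: B_def algebra_simps)
    also have "\<dots> \<le> N * (1 * (\<epsilon> * A) + Lf * Cg * \<epsilon> * T)"
      using A N Lf_nonneg Cg_nonneg eps_pos t
      by (intro mult_left_mono add_mono mult_right_mono) auto
    finally show "B t - B 0 \<le> N * (A + Lf * Cg * T) * \<epsilon>" by (simp add: algebra_simps)
    have "0 \<le> 1 - exp (- (t / \<epsilon>))" using t eps_pos by simp
    then have "0 \<le> B t - B 0"
      unfolding \<open>B t - B 0 = _\<close> using A N Lf_nonneg Cg_nonneg eps_pos t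
      by (intro mult_nonneg_nonneg add_nonneg_nonneg) auto
    then show "0 \<le> norm (y 0 - Y 0) + (B t - B 0)" by simp
  qed auto
  finally show ?thesis by (simp add: A_def N_def)
qed

text \<open>A step of length \<open>h\<close> multiplies the mode of rate \<open>\<lambda>\<close> by \<open>1 - h / \<epsilon> * \<lambda>\<close>. For \<open>1 \<le> \<lambda> \<le> lmax\<close> the
  largest modulus is attained at an end point; the two end points are in balance at
  \<open>h = 2 * \<epsilon> / (lmax + 1)\<close>, the slow mode prevails below and the stiff mode above.\<close>

lemma contraction_slow_mode:
  assumes h: "0 \<le> h" "h \<le> 2 * \<epsilon> / (lmax + 1)"
  shows "\<bar>1 - h / \<epsilon> * \<Lambda> $ i $ i\<bar> \<le> 1 - h / \<epsilon>"
proof -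
  define c where "c = h / \<epsilon>"
  have c: "0 \<le> c" using h eps_pos by (simp add: c_def)
  have "h * (lmax + 1) \<le> 2 * \<epsilon>" using h(2) lmax_ge_1 by (simp add: pos_le_divide_eq)
  then have "c * lmax + c \<le> 2" using eps_pos by (simp add: c_def field_simps)
  moreover have "c * 1 \<le> c * \<Lambda> $ i $ i" "c * \<Lambda> $ i $ i \<le> c * lmax"
    using c by (intro mult_left_mono rate_ge rate_le; simp)+
  ultimately show ?thesis unfolding c_def [symmetric] by linarith
qed

lemma contraction_stiff_mode:
  assumes h: "2 * \<epsilon> / (lmax + 1) < h"
  shows "\<bar>1 - h / \<epsilon> * \<Lambda> $ i $ i\<bar> \<le> 1 - (2 * \<epsilon> - lmax * h) / \<epsilon>"
proof -
  define c where "c = h / \<epsilon>"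
  have "0 < 2 * \<epsilon> / (lmax + 1)" using eps_pos lmax_ge_1 by simp
  then have c: "0 \<le> c" using h eps_pos by (simp add: c_def)
  have "2 * \<epsilon> < h * (lmax + 1)" using h lmax_ge_1 by (simp add: pos_divide_less_eq)
  then have "2 < c * lmax + c" using eps_pos by (simp add: c_def field_simps)
  moreover have "c * 1 \<le> c * \<Lambda> $ i $ i" "c * \<Lambda> $ i $ i \<le> c * lmax"
    using c by (intro mult_left_mono rate_ge rate_le; simp)+
  moreover have "(2 * \<epsilon> - lmax * h) / \<epsilon> = 2 - c * lmax"
    using eps_pos by (simp add: c_def field_simps)
  ultimately show ?thesis unfolding c_def [symmetric] by linarith
qed

end

section \<open>Projective integration of the slow-fast system\<close>

text \<open>The number \<open>\<tau>\<close> is the effective relaxation time of the microsolver: one microstep contracts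
  the distance to the centre manifold by \<open>1 - \<delta>t / \<tau>\<close>. Both stability regimes of the microstep are
  instances, with \<open>\<tau> = \<epsilon>\<close> when the slowest fast mode dominates and
  \<open>\<tau> = \<epsilon> * \<delta>t / (2 * \<epsilon> - lmax * \<delta>t)\<close> when the stiffest mode overshoots and dominates.\<close>

locale projective_integration = slow_fast_system \<Lambda> f g lmax Lf Lg Cg \<epsilon>
  for \<Lambda> :: "real^'m^'m" and f :: "real^'n \<Rightarrow> real^'m" and g lmax Lf Lg Cg \<epsilon> +
  fixes \<delta>t \<Delta>t \<tau> H :: real and M :: nat
  assumes micro_pos: "0 < \<delta>t" and macro_pos: "0 < \<Delta>t"
    and step_length: "H = \<Delta>t + real M * \<delta>t"
    and relaxation_time: "\<epsilon> \<le> \<tau>"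
    and micro_contraction: "\<And>i. \<bar>1 - \<delta>t / \<epsilon> * \<Lambda> $ i $ i\<bar> \<le> 1 - \<delta>t / \<tau>"
    and macro_unstable: "2 * \<epsilon> \<le> lmax * \<Delta>t"
begin

abbreviation E :: real where "E \<equiv> exp (- (real M * \<delta>t / \<tau>))"
abbreviation micro :: "nat \<Rightarrow> (real^'m) \<times> (real^'n) \<Rightarrow> (real^'m) \<times> (real^'n)" where
  "micro k \<equiv> euler_step \<Lambda> f g \<epsilon> \<delta>t ^^ k"
abbreviation step :: "(real^'m) \<times> (real^'n) \<Rightarrow> (real^'m) \<times> (real^'n)" where
  "step \<equiv> pi_step \<Lambda> f g \<epsilon> \<delta>t \<Delta>t M"

lemma tau_pos: "0 < \<tau>"
  using eps_pos relaxation_time by linarith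

lemma H_pos: "0 < H"
  using macro_pos micro_pos by (simp add: step_length add_pos_nonneg)

lemma contraction_factor: "0 \<le> 1 - \<delta>t / \<tau>" "1 - \<delta>t / \<tau> < 1"
proof -
  show "0 \<le> 1 - \<delta>t / \<tau>" using micro_contraction [of undefined] by linarith
  show "1 - \<delta>t / \<tau> < 1" using micro_pos tau_pos by simp
qed

lemma contraction_power_le: "(1 - \<delta>t / \<tau>) ^ M \<le> E"
proof -
  have "1 - \<delta>t / \<tau> \<le> exp (- (\<delta>t / \<tau>))"
    using exp_ge_add_one_self [of "- (\<delta>t / \<tau>)"] by simp
  then have "(1 - \<delta>t / \<tau>) ^ M \<le> exp (- (\<delta>t / \<tau>)) ^ M"
    using contraction_factor by (intro power_mono)
  then show ?thesis by (simp add: exp_of_nat_mult [symmetric])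
qed

lemma manifold_dist_micro:
  "D (micro k q) \<le> (1 - \<delta>t / \<tau>) ^ k * D q + Lf * Cg * \<tau>"
proof -
  have rec: "D (micro (Suc j) q) \<le> (1 - \<delta>t / \<tau>) * D (micro j q) + Lf * Cg * \<delta>t" for j
    using manifold_dist_euler_step [OF _ micro_contraction, of "micro j q"] micro_pos by simp
  have "D (micro k q) \<le> (1 - \<delta>t / \<tau>) ^ k * D (micro 0 q)
      + Lf * Cg * \<delta>t * (1 - (1 - \<delta>t / \<tau>) ^ k) / (1 - (1 - \<delta>t / \<tau>))"
    by (rule affine_recursion_bound [of "\<lambda>j. D (micro j q)", OF rec contraction_factor])
  also have "Lf * Cg * \<delta>t * (1 - (1 - \<delta>t / \<tau>) ^ k) / (1 - (1 - \<delta>t / \<tau>))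
      = Lf * Cg * \<tau> * (1 - (1 - \<delta>t / \<tau>) ^ k)"
    using micro_pos tau_pos by simp
  also have "\<dots> \<le> Lf * Cg * \<tau>"
    using contraction_factor Lf_nonneg Cg_nonneg tau_pos by (intro mult_left_le) auto
  finally show ?thesis by simp
qed

lemma manifold_dist_micro_M: "D (micro M q) \<le> E * D q + Lf * Cg * \<tau>"
  using manifold_dist_micro [of M q] mult_right_mono [OF contraction_power_le D_nonneg [of q]]
  by linarith

text \<open>The macrostep lies beyond the stability limit of the stiffest mode and multiplies that
  mode by \<open>1 - lmax * \<Delta>t / \<epsilon> \<le> -1\<close>; the preceding microsteps have damped it by \<open>E\<close>.\<close>

lemma manifold_dist_step:
  "D (step q) \<le> \<Delta>t * lmax * E / \<epsilon> * D q + Lf * Cg * (1 + \<tau> / \<epsilon> * lmax) * \<Delta>t"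
proof -
  have "\<bar>1 - \<Delta>t / \<epsilon> * \<Lambda> $ i $ i\<bar> \<le> lmax * \<Delta>t / \<epsilon>" for i
  proof -
    have c: "0 < \<Delta>t / \<epsilon>" using macro_pos eps_pos by simp
    have "\<Delta>t / \<epsilon> * \<Lambda> $ i $ i \<le> lmax * \<Delta>t / \<epsilon>"
      using mult_left_mono [OF rate_le [of i], of "\<Delta>t / \<epsilon>"] c by (simp add: mult_ac)
    moreover have "0 \<le> \<Delta>t / \<epsilon> * \<Lambda> $ i $ i"
      using c rate_ge [of i] by (intro mult_nonneg_nonneg) auto
    moreover have "2 \<le> lmax * \<Delta>t / \<epsilon>"
      using macro_unstable eps_pos by (simp add: pos_le_divide_eq)
    ultimately show ?thesis by linarith
  qed
  then have "D (step q) \<le> lmax * \<Delta>t / \<epsilon> * D (micro M q) + Lf * Cg * \<Delta>t"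
    unfolding pi_step_def using macro_pos by (intro manifold_dist_euler_step) auto
  also have "\<dots> \<le> lmax * \<Delta>t / \<epsilon> * (E * D q + Lf * Cg * \<tau>) + Lf * Cg * \<Delta>t"
    using macro_pos eps_pos lmax_ge_1
    by (intro add_right_mono mult_left_mono manifold_dist_micro_M) auto
  also have "\<dots> = \<Delta>t * lmax * E / \<epsilon> * D q + Lf * Cg * (1 + \<tau> / \<epsilon> * lmax) * \<Delta>t"
    using eps_pos by (simp add: field_simps)
  finally show ?thesis .
qed

lemma manifold_dist_iterates:
  assumes damped: "\<Delta>t * E < \<epsilon> / lmax"
  shows "D ((step ^^ k) q) \<le> D q
    + \<epsilon> * Lf * Cg * (1 + \<tau> / \<epsilon> * lmax) * \<Delta>t / (\<epsilon> - \<Delta>t * lmax * E)"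
proof -
  have lmax: "0 < lmax" using lmax_ge_1 by linarith
  have small: "\<Delta>t * lmax * E < \<epsilon>"
    using damped lmax by (simp add: pos_less_divide_eq mult_ac)
  have "D ((step ^^ k) q) \<le> D ((step ^^ 0) q)
      + Lf * Cg * (1 + \<tau> / \<epsilon> * lmax) * \<Delta>t / (1 - \<Delta>t * lmax * E / \<epsilon>)"
  proof (rule affine_recursion_uniform_bound)
    show "D ((step ^^ Suc j) q) \<le> \<Delta>t * lmax * E / \<epsilon> * D ((step ^^ j) q)
        + Lf * Cg * (1 + \<tau> / \<epsilon> * lmax) * \<Delta>t" for j
      using manifold_dist_step by simp
    show "\<Delta>t * lmax * E / \<epsilon> < 1" using small eps_pos by simp
  qed (use macro_pos eps_pos lmax Lf_nonneg Cg_nonneg tau_pos D_nonneg in auto)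
  also have "Lf * Cg * (1 + \<tau> / \<epsilon> * lmax) * \<Delta>t / (1 - \<Delta>t * lmax * E / \<epsilon>)
      = \<epsilon> * Lf * Cg * (1 + \<tau> / \<epsilon> * lmax) * \<Delta>t / (\<epsilon> - \<Delta>t * lmax * E)"
  proof -
    have "1 - \<Delta>t * lmax * E / \<epsilon> = (\<epsilon> - \<Delta>t * lmax * E) / \<epsilon>"
      using eps_pos by (simp add: diff_divide_distrib)
    then show ?thesis by (simp add: mult_ac)
  qed
  finally show ?thesis by simp
qed

lemma norm_slow_micro: "norm (snd (micro k q) - snd q) \<le> real k * \<delta>t * Cg"
proof (induction k)
  case (Suc k)
  have "norm (snd (micro (Suc k) q) - snd q)
      \<le> norm (snd (micro (Suc k) q) - snd (micro k q)) + norm (snd (micro k q) - snd q)"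
    using norm_triangle_ineq [of "snd (micro (Suc k) q) - snd (micro k q)" "snd (micro k q) - snd q"]
    by simp
  also have "norm (snd (micro (Suc k) q) - snd (micro k q)) \<le> \<delta>t * Cg"
    using norm_slow_euler_step [of \<delta>t "micro k q"] micro_pos by simp
  finally show ?case using Suc by (simp add: algebra_simps)
qed simp

text \<open>The initial distance to the manifold contributes \<open>\<tau>\<close> rather than \<open>k * \<delta>t\<close> in total, since it
  decays geometrically. The geometric sum is kept in closed form
  \<open>\<tau> * (1 - (1 - \<delta>t / \<tau>) ^ k)\<close>, which makes the induction telescope.\<close>

lemma slow_increment_micro:
  assumes k: "real k * \<delta>t \<le> H"
  shows "norm (snd (micro k q) - snd q - (real k * \<delta>t) *\<^sub>R G (snd q))
    \<le> Lg * \<tau> * (1 - (1 - \<delta>t / \<tau>) ^ k) * D q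
      + real k * \<delta>t * (Lg * Lf * Cg * \<tau> + L * Cg * H)"
  using k
proof (induction k)
  case (Suc k)
  let ?\<rho> = "1 - \<delta>t / \<tau>" and ?y = "snd q" and ?c = "Lg * Lf * Cg * \<tau> + L * Cg * H"
  have k: "real k * \<delta>t \<le> H" using Suc.prems micro_pos by (simp add: algebra_simps)
  have near: "norm (snd (micro k q) - ?y) \<le> Cg * H"
    using norm_slow_micro [of k q] mult_left_mono [OF k Cg_nonneg] by (simp add: mult_ac)
  have "norm (snd (micro (Suc k) q) - ?y - (real (Suc k) * \<delta>t) *\<^sub>R G ?y)
      \<le> norm (snd (micro k q) - ?y - (real k * \<delta>t) *\<^sub>R G ?y)
        + norm (snd (micro (Suc k) q) - snd (micro k q) - \<delta>t *\<^sub>R G ?y)"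
    by (rule order_trans [OF _ norm_triangle_ineq]) (simp add: algebra_simps)
  also have "\<dots> \<le> (Lg * \<tau> * (1 - ?\<rho> ^ k) * D q + real k * \<delta>t * ?c)
        + \<delta>t * (Lg * D (micro k q) + L * (Cg * H))"
    using Suc.IH [OF k] slow_increment_euler_step [OF _ near] micro_pos
    by (intro add_mono) auto
  also have "\<dots> \<le> (Lg * \<tau> * (1 - ?\<rho> ^ k) * D q + real k * \<delta>t * ?c)
        + \<delta>t * (Lg * (?\<rho> ^ k * D q + Lf * Cg * \<tau>) + L * (Cg * H))"
    using micro_pos Lg_nonneg
    by (intro add_left_mono mult_left_mono add_right_mono manifold_dist_micro) auto
  also have "\<dots> = Lg * \<tau> * (1 - ?\<rho> ^ k + \<delta>t / \<tau> * ?\<rho> ^ k) * D q + real (Suc k) * \<delta>t * ?c"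
    using tau_pos by (simp add: algebra_simps)
  also have "1 - ?\<rho> ^ k + \<delta>t / \<tau> * ?\<rho> ^ k = 1 - ?\<rho> ^ Suc k"
    by (simp add: left_diff_distrib)
  finally show ?case .
qed simp

lemma slow_increment_step:
  "norm (snd (step q) - snd q - H *\<^sub>R G (snd q))
    \<le> Lg * (\<tau> + \<Delta>t * E) * D q + Lg * Lf * Cg * \<tau> * H + L * Cg * H\<^sup>2"
proof -
  let ?y = "snd q" and ?m = "real M * \<delta>t"
  have m: "?m \<le> H" using macro_pos by (simp add: step_length)
  have near: "norm (snd (micro M q) - ?y) \<le> Cg * H"
    using norm_slow_micro [of M q] mult_left_mono [OF m Cg_nonneg] by (simp add: mult_ac)
  have "norm (snd (step q) - ?y - H *\<^sub>R G ?y)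
      \<le> norm (snd (micro M q) - ?y - ?m *\<^sub>R G ?y)
        + norm (snd (step q) - snd (micro M q) - \<Delta>t *\<^sub>R G ?y)"
  proof -
    have "H *\<^sub>R G ?y = \<Delta>t *\<^sub>R G ?y + ?m *\<^sub>R G ?y"
      by (simp add: step_length scaleR_add_left)
    then have "snd (step q) - ?y - H *\<^sub>R G ?y = (snd (micro M q) - ?y - ?m *\<^sub>R G ?y)
        + (snd (step q) - snd (micro M q) - \<Delta>t *\<^sub>R G ?y)"
      by simp
    then show ?thesis by (simp only: norm_triangle_ineq)
  qed
  also have "\<dots> \<le> (Lg * \<tau> * D q + ?m * (Lg * Lf * Cg * \<tau> + L * Cg * H))
        + \<Delta>t * (Lg * (E * D q + Lf * Cg * \<tau>) + L * (Cg * H))"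
  proof (rule add_mono)
    have "(1 - (1 - \<delta>t / \<tau>) ^ M) * (Lg * \<tau> * D q) \<le> 1 * (Lg * \<tau> * D q)"
      using contraction_factor Lg_nonneg tau_pos D_nonneg by (intro mult_right_mono) auto
    then show "norm (snd (micro M q) - ?y - ?m *\<^sub>R G ?y)
        \<le> Lg * \<tau> * D q + ?m * (Lg * Lf * Cg * \<tau> + L * Cg * H)"
      using slow_increment_micro [OF m, of q] by (simp add: mult_ac)
    have "norm (snd (step q) - snd (micro M q) - \<Delta>t *\<^sub>R G ?y)
        \<le> \<Delta>t * (Lg * D (micro M q) + L * (Cg * H))"
      unfolding pi_step_def using macro_pos by (intro slow_increment_euler_step near) simp
    also have "\<dots> \<le> \<Delta>t * (Lg * (E * D q + Lf * Cg * \<tau>) + L * (Cg * H))"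
      using macro_pos Lg_nonneg
      by (intro mult_left_mono add_right_mono manifold_dist_micro_M) auto
    finally show "norm (snd (step q) - snd (micro M q) - \<Delta>t *\<^sub>R G ?y)
        \<le> \<Delta>t * (Lg * (E * D q + Lf * Cg * \<tau>) + L * (Cg * H))" .
  qed
  also have "\<dots> = Lg * (\<tau> + \<Delta>t * E) * D q + (\<Delta>t + ?m) * (Lg * Lf * Cg * \<tau> + L * Cg * H)"
    by (simp add: algebra_simps)
  also have "\<Delta>t + ?m = H" by (rule step_length [symmetric])
  finally show ?thesis by (simp add: power2_eq_square algebra_simps)
qed

text \<open>Both the scheme and the reduced flow move the slow variable by \<open>H *\<^sub>R G\<close> up to their local
  errors, so one step multiplies the inherited error by at most \<open>1 + L * H\<close>.\<close>

lemma reduced_error_step: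
  assumes Y: "solves_ode G Y" and t: "0 \<le> t"
  shows "norm (Y (t + H) - snd (step q)) \<le> (1 + L * H) * norm (Y t - snd q)
    + (Lg * (\<tau> + \<Delta>t * E) * D q + Lg * Lf * Cg * \<tau> * H + 2 * L * Cg * H\<^sup>2)"
proof -
  let ?y = "snd q"
  have "norm (Y (t + H) - snd (step q))
      \<le> norm (Y t - ?y) + norm (H *\<^sub>R (G (Y t) - G ?y))
        + norm (Y (t + H) - Y t - H *\<^sub>R G (Y t))
        + norm (snd (step q) - ?y - H *\<^sub>R G ?y)"
    (is "norm ?d \<le> norm ?a + norm ?b + norm ?c + norm ?e")
  proof -
    have "?d = ((?a + ?b) + ?c) - ?e" by (simp add: algebra_simps)
    then have "norm ?d \<le> norm ((?a + ?b) + ?c) + norm ?e" by (simp only: norm_triangle_ineq4)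
    moreover have "norm ((?a + ?b) + ?c) \<le> norm (?a + ?b) + norm ?c" by (rule norm_triangle_ineq)
    moreover have "norm (?a + ?b) \<le> norm ?a + norm ?b" by (rule norm_triangle_ineq)
    ultimately show ?thesis by linarith
  qed
  moreover have "norm (H *\<^sub>R (G (Y t) - G ?y)) \<le> L * H * norm (Y t - ?y)"
    using mult_left_mono [OF reduced_field_lipschitz, of H] H_pos by (simp add: mult_ac)
  moreover have "norm (Y (t + H) - Y t - H *\<^sub>R G (Y t)) \<le> L * Cg * H\<^sup>2"
    using H_pos by (intro reduced_solution_taylor Y t) simp
  ultimately show ?thesis
    using slow_increment_step [of q] by (simp add: distrib_right)
qed

proposition reduced_error:
  assumes Y: "solves_ode G Y" and start: "snd q = Y 0"
    and d: "\<And>i. i < k \<Longrightarrow> D ((step ^^ i) q) \<le> d" "0 \<le> d" and T: "real k * H \<le> T"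
  shows "norm (Y (real k * H) - snd ((step ^^ k) q))
    \<le> exp (L * T) * T * (2 * L * Cg * H + Lg * Lf * Cg * \<tau> + Lg * (\<tau> / H + E) * d)"
proof -
  define e where "e i = norm (Y (real i * H) - snd ((step ^^ i) q))" for i
  define b where "b = 2 * L * Cg * H + Lg * Lf * Cg * \<tau> + Lg * (\<tau> / H + E) * d"
  have b: "0 \<le> b"
    unfolding b_def using L_nonneg Cg_nonneg Lg_nonneg Lf_nonneg tau_pos H_pos d
    by (intro add_nonneg_nonneg mult_nonneg_nonneg) auto
  have "e k \<le> exp (L * H * real k) * (real k * (H * b))"
  proof (rule discrete_gronwall)
    fix i assume i: "i < k"
    have "e (Suc i) \<le> (1 + L * H) * e i + (Lg * (\<tau> + \<Delta>t * E) * D ((step ^^ i) q)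
        + Lg * Lf * Cg * \<tau> * H + 2 * L * Cg * H\<^sup>2)"
      using reduced_error_step [OF Y, of "real i * H" "(step ^^ i) q"] H_pos
      by (simp add: e_def algebra_simps)
    also have "Lg * (\<tau> + \<Delta>t * E) * D ((step ^^ i) q) \<le> Lg * (\<tau> + H * E) * d"
    proof (rule mult_mono)
      have "\<Delta>t * E \<le> H * E" using micro_pos by (intro mult_right_mono) (auto simp: step_length)
      then show "Lg * (\<tau> + \<Delta>t * E) \<le> Lg * (\<tau> + H * E)"
        using Lg_nonneg by (intro mult_left_mono) auto
    qed (use d i D_nonneg Lg_nonneg tau_pos H_pos in auto)
    also have "Lg * (\<tau> + H * E) * d = H * (Lg * (\<tau> / H + E) * d)"
      using H_pos by (simp add: field_simps)
    finally show "e (Suc i) \<le> (1 + L * H) * e i + H * b"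
      by (simp add: b_def power2_eq_square algebra_simps)
  qed (use start b L_nonneg H_pos in \<open>auto simp: e_def\<close>)
  also have "\<dots> = exp (L * (real k * H)) * ((real k * H) * b)" by (simp add: mult_ac)
  also have "\<dots> \<le> exp (L * T) * (T * b)"
  proof (intro mult_mono)
    have "0 \<le> real k * H" using H_pos by simp
    then show "0 \<le> T" using T by linarith
    show "exp (L * (real k * H)) \<le> exp (L * T)"
      using mult_left_mono [OF T L_nonneg] by simp
  qed (use T b H_pos in auto)
  finally show ?thesis by (simp add: e_def b_def mult.assoc)
qed

text \<open>Every term of the two partial estimates is, up to a constant, at most \<open>\<tau> / \<epsilon> \<ge> 1\<close> times the
  bracket below: it contains either no \<open>\<tau>\<close> or one factor \<open>\<tau> = (\<tau> / \<epsilon>) * \<epsilon>\<close>.\<close>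

proposition projective_integration_error:
  assumes sol: "solves_full \<Lambda> f g \<epsilon> x y" and Y: "solves_ode G Y"
    and start: "snd q = Y 0" and y0: "norm (y 0 - Y 0) \<le> cy * \<epsilon>" and x0: "D (x 0, y 0) \<le> cx"
    and d: "\<And>i. i < k \<Longrightarrow> D ((step ^^ i) q) \<le> d" "0 \<le> d" and T: "real k * H \<le> T"
  shows "norm (y (real k * H) - snd ((step ^^ k) q))
    \<le> exp (L * T) * (cy + Lg * CARD('m) * (cx + Lf * Cg * T) + T * (2 * L * Cg + Lg * Lf * Cg + Lg))
      * (\<tau> / \<epsilon>) * (H + \<epsilon> + (\<epsilon> / H + \<epsilon> + E) * d)"
proof -
  define r where "r = \<tau> / \<epsilon>"
  define P where "P = H + \<epsilon> + (\<epsilon> / H + \<epsilon> + E) * d"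
  define S where "S = cy + Lg * CARD('m) * (cx + Lf * Cg * T)"
  define K where "K = 2 * L * Cg + Lg * Lf * Cg + Lg"
  have t: "0 \<le> real k * H" using H_pos by simp
  have T_nonneg: "0 \<le> T" using t T by linarith
  have r: "1 \<le> r" using relaxation_time eps_pos by (simp add: r_def)
  have \<tau>: "\<tau> = r * \<epsilon>" using eps_pos by (simp add: r_def)
  have parts: "0 \<le> \<epsilon> / H * d" "0 \<le> \<epsilon> * d" "0 \<le> E * d"
    using eps_pos H_pos d by auto
  have P: "H \<le> P" "\<epsilon> \<le> P" "(\<epsilon> / H + E) * d \<le> P"
    unfolding P_def distrib_right using parts eps_pos H_pos by linarith+
  have P_le: "P \<le> r * P" using mult_right_mono [OF r, of P] P(2) eps_pos by simp
  have cx: "0 \<le> cx" using x0 D_nonneg [of "(x 0, y 0)"] by linarith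
  have cy: "0 \<le> cy"
    using order_trans [OF norm_ge_zero y0] eps_pos by (simp add: zero_le_mult_iff)
  have S: "0 \<le> S"
    unfolding S_def using cx cy T_nonneg Lg_nonneg Lf_nonneg Cg_nonneg by auto

  have "norm (y (real k * H) - Y (real k * H)) \<le> exp (L * T)
      * (norm (y 0 - Y 0) + Lg * CARD('m) * (D (x 0, y 0) + Lf * Cg * T) * \<epsilon>)"
    by (rule full_reduced_distance [OF sol Y t T])
  also have "\<dots> \<le> exp (L * T) * (cy * \<epsilon> + Lg * CARD('m) * (cx + Lf * Cg * T) * \<epsilon>)"
    using y0 x0 Lg_nonneg Lf_nonneg Cg_nonneg T_nonneg eps_pos
    by (intro mult_left_mono add_mono mult_right_mono) auto
  also have "\<dots> = exp (L * T) * (S * \<epsilon>)" by (simp add: S_def distrib_right)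
  also have "\<dots> \<le> exp (L * T) * (S * (r * P))"
    using P(2) P_le S by (intro mult_left_mono) auto
  finally have full: "norm (y (real k * H) - Y (real k * H)) \<le> exp (L * T) * (S * (r * P))" .

  have "norm (Y (real k * H) - snd ((step ^^ k) q))
      \<le> exp (L * T) * T * (2 * L * Cg * H + Lg * Lf * Cg * \<tau> + Lg * ((\<tau> / H + E) * d))"
    using reduced_error [OF Y start d T] by (simp add: mult.assoc)
  also have "\<dots> \<le> exp (L * T) * T * (2 * L * Cg * (r * P) + Lg * Lf * Cg * (r * P) + Lg * (r * P))"
  proof -
    have "H \<le> r * P" using P(1) P_le by linarith
    moreover have "\<tau> \<le> r * P" using mult_left_mono [OF P(2), of r] r by (simp add: \<tau>)
    moreover have "(\<tau> / H + E) * d \<le> r * P"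
    proof -
      have "E * d \<le> r * (E * d)" using mult_right_mono [OF r parts(3)] by simp
      then have "(\<tau> / H + E) * d \<le> r * ((\<epsilon> / H + E) * d)" by (simp add: \<tau> algebra_simps)
      also have "\<dots> \<le> r * P" using P(3) r by (intro mult_left_mono) auto
      finally show ?thesis .
    qed
    ultimately show ?thesis
      using T_nonneg L_nonneg Lg_nonneg Lf_nonneg Cg_nonneg
      by (intro mult_left_mono add_mono) auto
  qed
  also have "\<dots> = exp (L * T) * (T * K * (r * P))" by (simp add: K_def algebra_simps)
  finally have reduced: "norm (Y (real k * H) - snd ((step ^^ k) q)) \<le> exp (L * T) * (T * K * (r * P))" .

  have "norm (y (real k * H) - snd ((step ^^ k) q))
      \<le> norm (y (real k * H) - Y (real k * H)) + norm (Y (real k * H) - snd ((step ^^ k) q))"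
    using norm_triangle_ineq [of "y (real k * H) - Y (real k * H)"
        "Y (real k * H) - snd ((step ^^ k) q)"] by simp
  also have "\<dots> \<le> exp (L * T) * (S * (r * P)) + exp (L * T) * (T * K * (r * P))"
    by (rule add_mono [OF full reduced])
  also have "\<dots> = exp (L * T) * (S + T * K) * r * P" by (simp add: distrib_left distrib_right mult_ac)
  finally show ?thesis unfolding S_def K_def r_def P_def .
qed

end

lemma manifold_dist_le_max:
  "i < n \<Longrightarrow> manifold_dist \<Lambda> f (p i) \<le> max_manifold_dist \<Lambda> f p n"
  unfolding max_manifold_dist_def by (rule Max_ge) auto

lemma max_manifold_dist_le:
  assumes "1 \<le> n" and "\<And>i. manifold_dist \<Lambda> f (p i) \<le> b"
  shows "max_manifold_dist \<Lambda> f p n \<le> b"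
  unfolding max_manifold_dist_def using assms by (subst Max_le_iff) auto

section \<open>The error estimate\<close>

theorem theorem4p1:
  fixes \<Lambda> :: "real^'m^'m"
    and f :: "real^'n \<Rightarrow> real^'m"
    and g :: "real^'m \<Rightarrow> real^'n \<Rightarrow> real^'n"
    and G :: "real^'n \<Rightarrow> real^'n"
    and lmax Lf Lg LG Cg T :: real
    and c0y :: "real^'n" and c0x :: "real^'m"
  assumes diag: "diagonal_matrix \<Lambda>"
    and diag_pos: "\<forall>i. 0 < \<Lambda> $ i $ i"
    and diag_min: "Min (range (\<lambda>i. \<Lambda> $ i $ i)) = 1"
    and diag_max: "Max (range (\<lambda>i. \<Lambda> $ i $ i)) = lmax"
    and fixed_point: "g 0 0 = 0" "- (\<Lambda> *v 0) + f 0 = 0"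
    and G: "G = reduced_field \<Lambda> f g"
    and A1: "Lf-lipschitz_on UNIV f"
    and A2: "\<forall>x1 x2 y1 y2. norm (g x1 y1 - g x2 y2) \<le> Lg * (norm (x1 - x2) + norm (y1 - y2))"
    and A3: "bdd_above (range (\<lambda>y. norm (f y)))"
    and A4: "bdd_above (range (\<lambda>(x, y). norm (g x y)))"
    and Cg: "Cg = (SUP (x, y). norm (g x y))"
    and A5: "C1_on_UNIV G"
            "bdd_above {norm (second_derivative Y t) | Y t. solves_ode G Y \<and> 0 \<le> t}"
    and LG: "LG-lipschitz_on UNIV G" "LG \<le> Lg * (1 + Lf)"
    and T: "0 < T"
  shows "\<exists>C. \<forall>\<epsilon> \<delta>t \<Delta>t :: real. \<forall>M n :: nat.
           \<forall>(x0 :: real^'m) Y x\<epsilon> y\<epsilon> \<delta>s t\<Delta> p d.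
      0 < \<epsilon> \<and> \<epsilon> < 1 \<and> 0 < \<delta>t \<and> 0 < \<Delta>t \<and> 1 \<le> M \<and>
      \<delta>s = 2 * \<epsilon> - lmax * \<delta>t \<and>
      t\<Delta> = \<Delta>t + real M * \<delta>t \<and>
      \<comment> \<open>(A6)\<close>
      \<delta>t \<le> 2 * \<epsilon> / lmax \<and> 2 * \<epsilon> / lmax < \<Delta>t \<and>
      \<comment> \<open>(A7)\<close>
      LG * real M * \<delta>t \<le> Lg * (1 + Lf) * real M * \<delta>t \<and> Lg * (1 + Lf) * real M * \<delta>t \<le> 1 \<and>
      \<comment> \<open>(A8)\<close>
      (\<delta>t \<le> 2 * \<epsilon> / (lmax + 1) \<longrightarrow> \<Delta>t * exp (- (real M * \<delta>t / \<epsilon>)) < \<epsilon> / lmax) \<and>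
      (2 * \<epsilon> / (lmax + 1) < \<delta>t \<and> \<delta>t < 2 * \<epsilon> / lmax \<longrightarrow>
         \<Delta>t * exp (- (real M * \<delta>s / \<epsilon>)) < \<epsilon> / lmax) \<and>
      \<comment> \<open>solutions of the reduced and the full system, and the scheme\<close>
      solves_ode G Y \<and>
      solves_full \<Lambda> f g \<epsilon> x\<epsilon> y\<epsilon> \<and>
      y\<epsilon> 0 = Y 0 + \<epsilon> *\<^sub>R c0y \<and>
      x\<epsilon> 0 = fbar \<Lambda> f (y\<epsilon> 0) + c0x \<and>
      p = pi_iter \<Lambda> f g \<epsilon> \<delta>t \<Delta>t M x0 (Y 0) \<and>
      1 \<le> n \<and> real n * t\<Delta> \<le> T \<and>
      d = max_manifold_dist \<Lambda> f p n
      \<longrightarrow>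
      (\<delta>t \<le> 2 * \<epsilon> / (lmax + 1) \<longrightarrow>
         norm (y\<epsilon> (real n * t\<Delta>) - snd (p n))
           \<le> C * (t\<Delta> + \<epsilon> + (\<epsilon> / t\<Delta> + \<epsilon> + exp (- (real M * \<delta>t / \<epsilon>))) * d) \<and>
         d \<le> norm (x0 - fbar \<Lambda> f (Y 0))
               + \<epsilon> * Lf * Cg * (1 + lmax) * \<Delta>t
                 / (\<epsilon> - \<Delta>t * lmax * exp (- (real M * \<delta>t / \<epsilon>)))) \<and>
      (2 * \<epsilon> / (lmax + 1) < \<delta>t \<and> \<delta>t < 2 * \<epsilon> / lmax \<longrightarrow>
         norm (y\<epsilon> (real n * t\<Delta>) - snd (p n))
           \<le> C * (\<delta>t / \<delta>s) * (t\<Delta> + \<epsilon> + (\<epsilon> / t\<Delta> + \<epsilon> + exp (- (real M * \<delta>s / \<epsilon>))) * d) \<and>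
         d \<le> norm (x0 - fbar \<Lambda> f (Y 0))
               + \<epsilon> * Lf * Cg * (1 + \<delta>t / \<delta>s * lmax) * \<Delta>t
                 / (\<epsilon> - \<Delta>t * lmax * exp (- (real M * \<delta>s / \<epsilon>))))"
proof -
  define L where "L = Lg * (1 + Lf)"
  define C where "C = exp (L * T) * (norm c0y + Lg * CARD('m) * (norm c0x + Lf * Cg * T)
    + T * (2 * L * Cg + Lg * Lf * Cg + Lg))"
  have rates: "1 \<le> \<Lambda> $ i $ i" "\<Lambda> $ i $ i \<le> lmax" for i
    unfolding diag_min [symmetric] diag_max [symmetric] by simp_all
  have lmax: "1 \<le> lmax" using rates [of undefined] by linarith
  have Lg: "0 \<le> Lg"
  proof -
    have "0 \<le> Lg * (norm (axis undefined 1 - 0 :: real^'m) + norm (0 - 0 :: real^'n))"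
      using A2 [rule_format, of "axis undefined 1" 0 0 0] norm_ge_zero order_trans by blast
    then show ?thesis by simp
  qed
  have g_le: "norm (g x y) \<le> Cg" for x y
    unfolding Cg using cSUP_upper [OF UNIV_I A4, of "(x, y)"] by simp
  have system: "slow_fast_system \<Lambda> f g lmax Lf Lg Cg \<epsilon>" if "0 < \<epsilon>" for \<epsilon>
  proof
    show "norm (f y1 - f y2) \<le> Lf * norm (y1 - y2)" for y1 y2
      using lipschitz_onD [OF A1, of y1 y2] by (simp add: dist_norm)
  qed (use diag rates A2 g_le Lg lipschitz_on_nonneg [OF A1] that in auto)
  show ?thesis
  proof (intro exI [of _ C] allI impI, elim conjE)
    fix \<epsilon> \<delta>t \<Delta>t :: real and M n :: nat and x0 :: "real^'m" and Y x\<epsilon> y\<epsilon> \<delta>s t\<Delta> p d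
    assume eps: "0 < \<epsilon>" and steps: "0 < \<delta>t" "0 < \<Delta>t"
      and \<delta>s: "\<delta>s = 2 * \<epsilon> - lmax * \<delta>t" and t\<Delta>: "t\<Delta> = \<Delta>t + real M * \<delta>t"
      and macro: "2 * \<epsilon> / lmax < \<Delta>t"
      and damped_slow:
        "\<delta>t \<le> 2 * \<epsilon> / (lmax + 1) \<longrightarrow> \<Delta>t * exp (- (real M * \<delta>t / \<epsilon>)) < \<epsilon> / lmax"
      and damped_stiff: "2 * \<epsilon> / (lmax + 1) < \<delta>t \<and> \<delta>t < 2 * \<epsilon> / lmax \<longrightarrow>
        \<Delta>t * exp (- (real M * \<delta>s / \<epsilon>)) < \<epsilon> / lmax"
      and Y: "solves_ode G Y" and sol: "solves_full \<Lambda> f g \<epsilon> x\<epsilon> y\<epsilon>"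
      and y0: "y\<epsilon> 0 = Y 0 + \<epsilon> *\<^sub>R c0y" and x\<epsilon>0: "x\<epsilon> 0 = fbar \<Lambda> f (y\<epsilon> 0) + c0x"
      and p: "p = pi_iter \<Lambda> f g \<epsilon> \<delta>t \<Delta>t M x0 (Y 0)"
      and n: "1 \<le> n" and T_le: "real n * t\<Delta> \<le> T" and d: "d = max_manifold_dist \<Lambda> f p n"
    have macro': "2 * \<epsilon> \<le> lmax * \<Delta>t"
      using macro lmax by (simp add: pos_divide_less_eq mult.commute)
    \<comment> \<open>Both regimes at once: only the effective relaxation time \<open>\<tau>\<close> distinguishes them.\<close>
    have bounds: "norm (y\<epsilon> (real n * t\<Delta>) - snd (p n)) \<le> C * (\<tau> / \<epsilon>)
          * (t\<Delta> + \<epsilon> + (\<epsilon> / t\<Delta> + \<epsilon> + exp (- (real M * \<delta>t / \<tau>))) * d) \<and>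
        d \<le> norm (x0 - fbar \<Lambda> f (Y 0)) + \<epsilon> * Lf * Cg * (1 + \<tau> / \<epsilon> * lmax) * \<Delta>t
          / (\<epsilon> - \<Delta>t * lmax * exp (- (real M * \<delta>t / \<tau>)))"
      if \<tau>: "\<epsilon> \<le> \<tau>" and contraction: "\<And>i. \<bar>1 - \<delta>t / \<epsilon> * \<Lambda> $ i $ i\<bar> \<le> 1 - \<delta>t / \<tau>"
        and damped: "\<Delta>t * exp (- (real M * \<delta>t / \<tau>)) < \<epsilon> / lmax" for \<tau>
    proof -
      interpret slow_fast_system \<Lambda> f g lmax Lf Lg Cg \<epsilon> by (rule system [OF eps])
      interpret projective_integration \<Lambda> f g lmax Lf Lg Cg \<epsilon> \<delta>t \<Delta>t \<tau> t\<Delta> M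
        by unfold_locales (fact steps t\<Delta> \<tau> contraction macro')+
      have p_eq: "p i = (pi_step \<Lambda> f g \<epsilon> \<delta>t \<Delta>t M ^^ i) (x0, Y 0)" for i
        by (simp add: p pi_iter_def)
      have d_ge: "manifold_dist \<Lambda> f (p i) \<le> d" if "i < n" for i
        unfolding d by (rule manifold_dist_le_max [OF that])
      show ?thesis
      proof
        have "0 \<le> d" using d_ge [of 0] D_nonneg [of "p 0"] n by linarith
        then show "norm (y\<epsilon> (real n * t\<Delta>) - snd (p n)) \<le> C * (\<tau> / \<epsilon>)
            * (t\<Delta> + \<epsilon> + (\<epsilon> / t\<Delta> + \<epsilon> + exp (- (real M * \<delta>t / \<tau>))) * d)"
          unfolding C_def L_def p_eq
          using Y d_ge eps
          by (intro projective_integration_error [OF sol _ _ _ _ _ _ T_le])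
            (auto simp: G p_eq y0 x\<epsilon>0 manifold_dist_def)
        show "d \<le> norm (x0 - fbar \<Lambda> f (Y 0)) + \<epsilon> * Lf * Cg * (1 + \<tau> / \<epsilon> * lmax) * \<Delta>t
            / (\<epsilon> - \<Delta>t * lmax * exp (- (real M * \<delta>t / \<tau>)))"
          unfolding d
          using manifold_dist_iterates [OF damped, of _ "(x0, Y 0)"]
          by (intro max_manifold_dist_le n) (simp add: p_eq manifold_dist_def)
      qed
    qed
    show "(\<delta>t \<le> 2 * \<epsilon> / (lmax + 1) \<longrightarrow>
         norm (y\<epsilon> (real n * t\<Delta>) - snd (p n))
           \<le> C * (t\<Delta> + \<epsilon> + (\<epsilon> / t\<Delta> + \<epsilon> + exp (- (real M * \<delta>t / \<epsilon>))) * d) \<and>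
         d \<le> norm (x0 - fbar \<Lambda> f (Y 0))
               + \<epsilon> * Lf * Cg * (1 + lmax) * \<Delta>t
                 / (\<epsilon> - \<Delta>t * lmax * exp (- (real M * \<delta>t / \<epsilon>)))) \<and>
      (2 * \<epsilon> / (lmax + 1) < \<delta>t \<and> \<delta>t < 2 * \<epsilon> / lmax \<longrightarrow>
         norm (y\<epsilon> (real n * t\<Delta>) - snd (p n))
           \<le> C * (\<delta>t / \<delta>s) * (t\<Delta> + \<epsilon> + (\<epsilon> / t\<Delta> + \<epsilon> + exp (- (real M * \<delta>s / \<epsilon>))) * d) \<and>
         d \<le> norm (x0 - fbar \<Lambda> f (Y 0))
               + \<epsilon> * Lf * Cg * (1 + \<delta>t / \<delta>s * lmax) * \<Delta>t
                 / (\<epsilon> - \<Delta>t * lmax * exp (- (real M * \<delta>s / \<epsilon>))))"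
      (is "(?slow \<longrightarrow> ?A) \<and> (?stiff \<longrightarrow> ?B)")
    proof (intro conjI [of "?slow \<longrightarrow> ?A"] impI)
      assume slow: ?slow
      have "\<bar>1 - \<delta>t / \<epsilon> * \<Lambda> $ i $ i\<bar> \<le> 1 - \<delta>t / \<epsilon>" for i
        using slow_fast_system.contraction_slow_mode [OF system [OF eps]] steps slow by simp
      from bounds [OF order_refl this] show ?A
        using damped_slow slow eps by simp
    next
      assume stiff: ?stiff
      have \<delta>s_pos: "0 < \<delta>s"
        using stiff lmax by (simp add: \<delta>s pos_less_divide_eq mult.commute)
      \<comment> \<open>The microstep lies above the balance point \<open>2 * \<epsilon> / (lmax + 1)\<close>, and \<open>\<delta>s\<close> below it.\<close>
      have "\<delta>s \<le> \<delta>t"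
        using stiff lmax by (simp add: \<delta>s pos_divide_less_eq algebra_simps)
      define \<tau> where "\<tau> = \<epsilon> * (\<delta>t / \<delta>s)"
      have ratio: "\<tau> / \<epsilon> = \<delta>t / \<delta>s" using eps by (simp add: \<tau>_def)
      have rate: "\<delta>t / \<tau> = \<delta>s / \<epsilon>" using eps steps \<delta>s_pos by (simp add: \<tau>_def field_simps)
      have exponent: "real M * \<delta>t / \<tau> = real M * \<delta>s / \<epsilon>"
        using rate by (metis times_divide_eq_right)
      have "\<epsilon> * 1 \<le> \<epsilon> * (\<delta>t / \<delta>s)"
        using \<open>\<delta>s \<le> \<delta>t\<close> \<delta>s_pos eps by (intro mult_left_mono) auto
      then have "\<epsilon> \<le> \<tau>" by (simp add: \<tau>_def)
      moreover have "\<bar>1 - \<delta>t / \<epsilon> * \<Lambda> $ i $ i\<bar> \<le> 1 - \<delta>t / \<tau>" for i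
        unfolding rate \<delta>s
        using slow_fast_system.contraction_stiff_mode [OF system [OF eps]] stiff by simp
      ultimately show ?B
        using bounds [of \<tau>] damped_stiff stiff unfolding exponent ratio by blast
    qed
  qed
qed

end
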